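(* For any $a,b>0$ and $v\in[0,1]$ we have $$L_v(a,b)\leq L\big(a\sharp_v b,a\nabla_v b\big)\leq I\big(a\sharp_v b,a\nabla_v b\big)\leq\big(a\sharp_v b\big)\nabla\big(a\nabla_v b\big)$$ and $$a\sharp_v b\leq\big(a\nabla_v(a\sharp b)\big)\sharp_v\big((a\sharp b)\nabla_v b\big)\leq I_v(a,b).$$
   Context: For $a,b>0$ and $v\in[0,1]$: $a\nabla_v b=(1-v)a+vb$ and $a\sharp_v b=a^{1-v}b^v$; for $v=1/2$ write $a\nabla b=\frac{a+b}{2}$ and $a\sharp b=\sqrt{ab}$. The logarithmic mean is $L(a,b)=\frac{b-a}{\log b-\log a}$ for $a\ne b$, $L(a,a)=a$. The identric mean is $I(a,b)=e^{-1}\big(b^b/a^a\big)^{1/(b-a)}$ for $a\neq b$, $I(a,a)=a$. The weighted logarithmic mean $L_v$ and the weighted identric mean $I_v$ are defined, for $a\ne b$ and $v\in(0,1)$, by $$L_v(a,b)=\frac{1}{\log a-\log b}\left(\frac{1-v}{v}\big(a-a^{1-v}b^v\big)+\frac{v}{1-v}\big(a^{1-v}b^v-b\big)\right),$$ $$I_v(a,b)=\frac1e\,\big(a\nabla_v b\big)^{\frac{(1-2v)(a\nabla_v b)}{v(1-v)(b-a)}}\left(\frac{b^{\frac{vb}{1-v}}}{a^{\frac{(1-v)a}{v}}}\right)^{\frac1{b-a}},$$ with the limit values $L_0(a,b)=I_0(a,b)=a$, $L_1(a,b)=I_1(a,b)=b$, and $L_v(a,a)=I_v(a,a)=a$. 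*)

theory Defs
  imports Complex_Main
begin

text \<open>Means of positive reals \<open>a\<close>, \<open>b\<close> with weight \<open>v \<in> [0,1]\<close> on \<open>b\<close>; outside
  that range the values below carry no meaning.\<close>

definition weighted_arith_mean :: "real \<Rightarrow> real \<Rightarrow> real \<Rightarrow> real"
    ("_ \<nabla>\<^bsub>_\<^esub> _" [71, 0, 71] 70)
  where "a \<nabla>\<^bsub>v\<^esub> b = (1 - v) * a + v * b"

definition weighted_geom_mean :: "real \<Rightarrow> real \<Rightarrow> real \<Rightarrow> real"
    ("_ \<sharp>\<^bsub>_\<^esub> _" [71, 0, 71] 70)
  where "a \<sharp>\<^bsub>v\<^esub> b = a powr (1 - v) * b powr v"

definition arith_mean :: "real \<Rightarrow> real \<Rightarrow> real" (infix "\<nabla>" 70)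
  where "a \<nabla> b = (a + b) / 2"

definition geom_mean :: "real \<Rightarrow> real \<Rightarrow> real" (infix "\<sharp>" 70)
  where "a \<sharp> b = sqrt (a * b)"

lemma arith_mean_eq_weighted: "a \<nabla> b = a \<nabla>\<^bsub>1/2\<^esub> b"
  by (simp add: arith_mean_def weighted_arith_mean_def field_simps)

lemma geom_mean_eq_weighted:
  assumes "a > 0" "b > 0"
  shows "a \<sharp> b = a \<sharp>\<^bsub>1/2\<^esub> b"
  using assms by (simp add: geom_mean_def weighted_geom_mean_def powr_half_sqrt real_sqrt_mult)

definition log_mean :: "real \<Rightarrow> real \<Rightarrow> real" where
  "log_mean a b = (if a = b then a else (b - a) / (ln b - ln a))"

definition identric_mean :: "real \<Rightarrow> real \<Rightarrow> real" where
  "identric_mean a b =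
     (if a = b then a
      else exp (-1) * ((b powr b) / (a powr a)) powr (1 / (b - a)))"

text \<open>The cases \<open>v = 0\<close>, \<open>v = 1\<close> and \<open>a = b\<close> of the two weighted means are the limits of the
  generic formula; where they overlap, the prescribed values agree.\<close>

definition weighted_log_mean :: "real \<Rightarrow> real \<Rightarrow> real \<Rightarrow> real" where
  "weighted_log_mean v a b =
     (if v = 0 then a else if v = 1 then b else if a = b then a
      else 1 / (ln a - ln b) *
        ((1 - v) / v * (a - a powr (1 - v) * b powr v)
         + v / (1 - v) * (a powr (1 - v) * b powr v - b)))"

definition weighted_identric_mean :: "real \<Rightarrow> real \<Rightarrow> real \<Rightarrow> real" where
  "weighted_identric_mean v a b =
     (if v = 0 then a else if v = 1 then b else if a = b then a
      else 1 / exp 1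
        * (a \<nabla>\<^bsub>v\<^esub> b) powr ((1 - 2 * v) * (a \<nabla>\<^bsub>v\<^esub> b) / (v * (1 - v) * (b - a)))
        * ((b powr (v * b / (1 - v))) / (a powr ((1 - v) * a / v))) powr (1 / (b - a)))"

end

theory Submission
  imports Defs "HOL-Analysis.Analysis"
begin

text \<open>Write \<open>G = a \<sharp>\<^bsub>v\<^esub> b\<close> and \<open>A = a \<nabla>\<^bsub>v\<^esub> b\<close>. Then \<open>L\<^sub>v(a,b) = (1-v) L(G,a) + v L(G,b)\<close>, and \<open>L(G,\<cdot>)\<close> is
  concave because \<open>L(G,x)\<close> is the integral of \<open>G\<^sup>1\<^sup>-\<^sup>t x\<^sup>t\<close> over \<open>t \<in> [0,1]\<close>. Since \<open>1/L(x,y)\<close> and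
  \<open>ln I(x,y)\<close> are the averages of \<open>1/u\<close> and \<open>ln u\<close> over \<open>[x,y]\<close>, the next two inequalities are
  Jensen's inequality for \<open>ln\<close>.
  For the second chain, \<open>I\<^sub>v(a,b) = I(a,A)\<^sup>1\<^sup>-\<^sup>v I(A,b)\<^sup>v\<close>, which is at least \<open>sqrt (G A)\<close> because
  \<open>I(x,y) \<ge> sqrt (x y)\<close>. The middle term equals \<open>sqrt G ((1-v) sqrt a + v sqrt b)\<close>, and
  \<open>((1-v) sqrt a + v sqrt b)\<^sup>2 \<le> A\<close>.\<close>

section \<open>Weighted arithmetic and geometric means\<close>

lemma weighted_arith_mean_pos:
  assumes "a > 0" "b > 0" "0 \<le> v" "v \<le> 1"
  shows "a \<nabla>\<^bsub>v\<^esub> b > 0"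
  unfolding weighted_arith_mean_def using assms
  by (cases "v = 0") (auto intro: add_nonneg_pos)

lemma weighted_geom_mean_pos:
  assumes "a > 0" "b > 0"
  shows "a \<sharp>\<^bsub>v\<^esub> b > 0"
  using assms by (simp add: weighted_geom_mean_def)

lemma ln_weighted_geom_mean:
  assumes "a > 0" "b > 0"
  shows "ln (a \<sharp>\<^bsub>v\<^esub> b) = (1 - v) * ln a + v * ln b"
  using assms by (simp add: weighted_geom_mean_def ln_mult ln_powr)

lemma weighted_geom_mean_same: "a > 0 \<Longrightarrow> a \<sharp>\<^bsub>v\<^esub> a = a"
  by (simp add: weighted_geom_mean_def flip: powr_add)

lemma weighted_arith_mean_same: "a \<nabla>\<^bsub>v\<^esub> a = a"
  by (simp add: weighted_arith_mean_def algebra_simps)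

lemma weighted_geom_mean_le_arith_mean:
  assumes "a > 0" "b > 0" "0 \<le> v" "v \<le> 1"
  shows "a \<sharp>\<^bsub>v\<^esub> b \<le> a \<nabla>\<^bsub>v\<^esub> b"
  unfolding weighted_geom_mean_def weighted_arith_mean_def
  using assms by (intro Youngs_inequality_0) auto

section \<open>Logarithmic mean: integral form, concavity, and the weighted version\<close>

lemma log_mean_commute: "log_mean x y = log_mean y x"
  by (simp add: log_mean_def) (metis minus_diff_eq minus_divide_divide)

lemma log_mean_has_integral:
  assumes "x > 0" "y > 0"
  shows "((\<lambda>t. x \<sharp>\<^bsub>t\<^esub> y) has_integral log_mean x y) {0..1}"
proof (cases "x = y")
  case True
  with assms show ?thesis
    using has_integral_const_real[of x 0 1] by (simp add: weighted_geom_mean_same log_mean_def)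
next
  case False
  define d where "d = ln y - ln x"
  have d: "d \<noteq> 0" using False assms by (simp add: d_def)
  have eq: "x \<sharp>\<^bsub>t\<^esub> y = exp (ln x + t * d)" for t
    using assms by (simp add: weighted_geom_mean_def powr_def d_def algebra_simps flip: exp_add)
  \<comment> \<open>The antiderivative is the integrand divided by \<open>d\<close>; its endpoint
    values are \<open>y / d\<close> and \<open>x / d\<close>.\<close>
  have "((\<lambda>t. exp (ln x + t * d)) has_integral
      exp (ln x + 1 * d) / d - exp (ln x + 0 * d) / d) {0..1}"
    by (rule fundamental_theorem_of_calculus)
      (use d in \<open>auto intro!: derivative_eq_intros
         simp flip: has_real_derivative_iff_has_vector_derivative\<close>)
  moreover have "exp (ln x + 1 * d) / d - exp (ln x + 0 * d) / d = log_mean x y"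
    using assms False by (simp add: log_mean_def d_def diff_divide_distrib)
  ultimately show ?thesis by (simp add: eq)
qed

text \<open>By Young's inequality \<open>m powr (1 - t) * u powr t\<close> is at most
  \<open>(1 - t) * m + t * u\<close>, which is \<open>m powr (1 - t)\<close> times the tangent line
  of \<open>u powr t\<close> at \<open>m\<close>. Taking \<open>u = a\<close> and
  \<open>u = b\<close> and averaging with weights \<open>1 - v\<close> and \<open>v\<close> turns
  this bound into \<open>m\<close>; then the positive factor \<open>m powr (1 - t)\<close>
  cancels.\<close>

lemma powr_concave:
  fixes a b t v :: real
  assumes "a > 0" "b > 0" "0 \<le> v" "v \<le> 1" "0 \<le> t" "t \<le> 1"
  shows "(1 - v) * a powr t + v * b powr t \<le> (a \<nabla>\<^bsub>v\<^esub> b) powr t"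
proof -
  define m where "m = a \<nabla>\<^bsub>v\<^esub> b"
  have m: "m > 0" using assms weighted_arith_mean_pos by (simp add: m_def)
  have "(1 - v) * (m powr (1 - t) * a powr t) + v * (m powr (1 - t) * b powr t)
      \<le> (1 - v) * ((1 - t) * m + t * a) + v * ((1 - t) * m + t * b)"
    using assms m by (intro add_mono mult_left_mono Youngs_inequality_0) auto
  also have "\<dots> = m"
    by (simp add: m_def weighted_arith_mean_def algebra_simps)
  also have "\<dots> = m powr (1 - t) * m powr t"
    using m by (simp flip: powr_add)
  finally have "m powr (1 - t) * ((1 - v) * a powr t + v * b powr t) \<le> m powr (1 - t) * m powr t"
    by (simp add: algebra_simps)
  then show ?thesis using m by (simp add: m_def)
qed

lemma log_mean_concave:
  assumes "x > 0" "a > 0" "b > 0" "0 \<le> v" "v \<le> 1"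
  shows "(1 - v) * log_mean x a + v * log_mean x b \<le> log_mean x (a \<nabla>\<^bsub>v\<^esub> b)"
proof (rule has_integral_le)
  show "((\<lambda>t. (1 - v) * (x \<sharp>\<^bsub>t\<^esub> a) + v * (x \<sharp>\<^bsub>t\<^esub> b)) has_integral
      (1 - v) * log_mean x a + v * log_mean x b) {0..1}"
    using assms by (intro has_integral_add has_integral_mult_right log_mean_has_integral)
  show "((\<lambda>t. x \<sharp>\<^bsub>t\<^esub> (a \<nabla>\<^bsub>v\<^esub> b)) has_integral log_mean x (a \<nabla>\<^bsub>v\<^esub> b)) {0..1}"
    using assms by (intro log_mean_has_integral weighted_arith_mean_pos)
  \<comment> \<open>Concavity holds for the integrand at each fixed \<open>t\<close>, and
    integration over \<open>t\<close> preserves it.\<close>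
  show "(1 - v) * (x \<sharp>\<^bsub>t\<^esub> a) + v * (x \<sharp>\<^bsub>t\<^esub> b) \<le> x \<sharp>\<^bsub>t\<^esub> (a \<nabla>\<^bsub>v\<^esub> b)" if "t \<in> {0..1}" for t
  proof -
    have "x powr (1 - t) * ((1 - v) * a powr t + v * b powr t) \<le> x powr (1 - t) * (a \<nabla>\<^bsub>v\<^esub> b) powr t"
      using assms that by (intro mult_left_mono powr_concave) auto
    then show ?thesis by (simp add: weighted_geom_mean_def algebra_simps)
  qed
qed

lemma weighted_log_mean_eq:
  assumes "a > 0" "b > 0" "0 < v" "v < 1" "a \<noteq> b"
  shows "weighted_log_mean v a b = (1 - v) * log_mean (a \<sharp>\<^bsub>v\<^esub> b) a + v * log_mean (a \<sharp>\<^bsub>v\<^esub> b) b"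
proof -
  define g where "g = a \<sharp>\<^bsub>v\<^esub> b"
  have g: "g > 0" using assms by (simp add: g_def weighted_geom_mean_pos)
  define d where "d = ln a - ln b"
  have d: "d \<noteq> 0" using assms by (simp add: d_def)
  \<comment> \<open>On the logarithmic scale \<open>g\<close> lies at fraction \<open>v\<close> of
    the way from \<open>a\<close> to \<open>b\<close>. These differences are the denominators of the
    two logarithmic means, and they produce the factors \<open>(1 - v) / v\<close> and
    \<open>v / (1 - v)\<close>.\<close>
  have lg: "ln a - ln g = v * d" "ln b - ln g = - ((1 - v) * d)"
    using ln_weighted_geom_mean[of a b v] assms by (simp_all add: g_def d_def algebra_simps)
  have ne: "g \<noteq> a" "g \<noteq> b" using lg d assms by auto
  have "weighted_log_mean v a b = 1 / d * ((1 - v) / v * (a - g) + v / (1 - v) * (g - b))"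
    using assms by (simp add: weighted_log_mean_def d_def g_def weighted_geom_mean_def)
  also have "\<dots> = (1 - v) * ((a - g) / (v * d)) + v * ((b - g) / (- ((1 - v) * d)))"
    using assms d by (simp add: field_simps)
  also have "\<dots> = (1 - v) * log_mean g a + v * log_mean g b"
    using ne by (simp add: log_mean_def lg)
  finally show ?thesis by (simp add: g_def)
qed

section \<open>Identric mean: lower and upper bounds\<close>

lemma ln_identric_mean:
  assumes "x > 0" "y > 0" "x \<noteq> y"
  shows "ln (identric_mean x y) = (y * ln y - x * ln x) / (y - x) - 1"
  using assms by (simp add: identric_mean_def ln_mult ln_powr ln_div)

lemma identric_mean_pos:
  assumes "x > 0" "y > 0"
  shows "identric_mean x y > 0"
  using assms by (simp add: identric_mean_def)

lemma identric_mean_commute: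
  assumes "x > 0" "y > 0"
  shows "identric_mean x y = identric_mean y x"
proof (cases "x = y")
  case False
  have "ln (identric_mean x y) = ln (identric_mean y x)"
    using assms False
    by (simp add: ln_identric_mean) (metis minus_diff_eq minus_divide_divide)
  then show ?thesis using assms identric_mean_pos by simp
qed simp

lemma log_mean_le_identric_mean:
  assumes "x > 0" "y > 0"
  shows "log_mean x y \<le> identric_mean x y"
  using assms
proof (induction x y rule: linorder_wlog)
  case (le x y)
  show ?case
  proof (cases "x = y")
    case True
    then show ?thesis by (simp add: log_mean_def identric_mean_def)
  next
    case False
    with le have xy: "0 < x" "x < y" "0 < y" by auto
    define c where "c = log_mean x y"
    have c_eq: "c * (ln y - ln x) = y - x" and c: "c > 0"
      using xy by (auto simp: c_def log_mean_def)
    \<comment> \<open>\<open>F\<close> is an antiderivative of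
      \<open>ln u - (ln c + 1 - c / u)\<close>, which is nonnegative because
      \<open>ln (c / u) \<le> c / u - 1\<close>. By \<open>c_eq\<close> the average of
      \<open>c / u\<close> over \<open>[x, y]\<close> is 1, so the average of \<open>ln u\<close> is
      at least \<open>ln c\<close>.\<close>
    define F where "F = (\<lambda>u. u * ln u - u - (u * ln c + u - c * ln u))"
    have "F x \<le> F y"
    proof (rule DERIV_nonneg_imp_nondecreasing[where f = F])
      fix u assume u: "x \<le> u" "u \<le> y"
      have "DERIV F u :> ln u - ln c - 1 + c / u"
        unfolding F_def using xy u by (auto intro!: derivative_eq_intros)
      moreover have "ln (c / u) \<le> c / u - 1"
        using xy u c by (intro ln_le_minus_one) simp
      ultimately show "\<exists>D. DERIV F u :> D \<and> D \<ge> 0"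
        using xy u c by (auto simp: ln_div)
    qed (use xy in simp)
    then have "(y - x) * (ln c + 1) \<le> y * ln y - x * ln x"
      using c_eq by (simp add: F_def algebra_simps)
    then have "ln c + 1 \<le> (y * ln y - x * ln x) / (y - x)"
      using xy by (simp add: pos_le_divide_eq mult.commute)
    then have "ln c \<le> ln (identric_mean x y)"
      using xy by (simp add: ln_identric_mean)
    then show ?thesis using c xy identric_mean_pos by (simp add: c_def)
  qed
next
  case (sym x y)
  then show ?case by (simp add: log_mean_commute[of x] identric_mean_commute)
qed

lemma identric_mean_le_arith_mean:
  assumes "x > 0" "y > 0"
  shows "identric_mean x y \<le> x \<nabla> y"
  using assms
proof (induction x y rule: linorder_wlog)
  case (le x y)
  show ?case
  proof (cases "x = y")
    case True
    then show ?thesis by (simp add: arith_mean_def identric_mean_def)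
  next
    case False
    with le have xy: "0 < x" "x < y" "0 < y" by auto
    define m where "m = x \<nabla> y"
    have m: "m > 0" "x + y = 2 * m" using xy by (auto simp: m_def arith_mean_def)
    \<comment> \<open>\<open>F\<close> integrates the gap between \<open>ln u\<close> and its
      tangent line at \<open>m\<close>, namely \<open>ln m + u / m - 1\<close>. As \<open>m\<close>
      is the midpoint, \<open>u / m\<close> averages to 1 over \<open>[x, y]\<close>, leaving
      \<open>ln m\<close> as an upper bound for the average of \<open>ln u\<close>.\<close>
    define F where "F = (\<lambda>u. u * ln m + u\<^sup>2 / (2 * m) - u * ln u)"
    have "F x \<le> F y"
    proof (rule DERIV_nonneg_imp_nondecreasing[where f = F])
      fix u assume u: "x \<le> u" "u \<le> y"
      have "DERIV F u :> ln m + u / m - 1 - ln u"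
        unfolding F_def using xy u m by (auto intro!: derivative_eq_intros)
      moreover have "ln (u / m) \<le> u / m - 1"
        using xy u m by (intro ln_le_minus_one) simp
      ultimately show "\<exists>D. DERIV F u :> D \<and> D \<ge> 0"
        using xy u m by (auto simp: ln_div)
    qed (use xy in simp)
    moreover have "y\<^sup>2 / (2 * m) - x\<^sup>2 / (2 * m) = y - x"
    proof -
      have "y\<^sup>2 - x\<^sup>2 = (y - x) * (2 * m)"
        unfolding m(2)[symmetric] by (simp add: power2_eq_square algebra_simps)
      then show ?thesis using m(1) by (simp flip: diff_divide_distrib)
    qed
    ultimately have "y * ln y - x * ln x \<le> (y - x) * (ln m + 1)"
      by (simp add: F_def algebra_simps)
    then have "(y * ln y - x * ln x) / (y - x) \<le> ln m + 1"
      using xy by (simp add: pos_divide_le_eq mult.commute)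
    then have "ln (identric_mean x y) \<le> ln m"
      using xy by (simp add: ln_identric_mean)
    then show ?thesis using m xy identric_mean_pos by (simp add: m_def)
  qed
next
  case (sym x y)
  then show ?case by (simp add: arith_mean_def add.commute identric_mean_commute)
qed

text \<open>The trapezoidal rule underestimates the average of the concave function
  \<open>ln\<close> between \<open>x\<close> and \<open>y\<close>.\<close>

lemma ln_identric_mean_ge:
  assumes "x > 0" "y > 0"
  shows "(ln x + ln y) / 2 \<le> ln (identric_mean x y)"
  using assms
proof (induction x y rule: linorder_wlog)
  case (le x y)
  show ?case
  proof (cases "x = y")
    case True
    then show ?thesis by (simp add: identric_mean_def)
  next
    case False
    with le have xy: "0 < x" "x < y" "0 < y" by auto
    \<comment> \<open>\<open>F u\<close> is the integral of \<open>ln\<close> over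
      \<open>[x, u]\<close> minus its trapezoidal approximation, so \<open>F x = 0\<close>.\<close>
    define F where "F = (\<lambda>u. u * ln u - x * ln x - (u - x) - (u - x) * (ln x + ln u) / 2)"
    have "F x \<le> F y"
    proof (rule DERIV_nonneg_imp_nondecreasing[where f = F])
      fix u assume u: "x \<le> u" "u \<le> y"
      have "DERIV F u :> (ln u - ln x - 1 + x / u) / 2"
        unfolding F_def using xy u
        by (auto intro!: derivative_eq_intros simp: field_simps)
      moreover have "ln (x / u) \<le> x / u - 1"
        using xy u by (intro ln_le_minus_one) simp
      ultimately show "\<exists>D. DERIV F u :> D \<and> D \<ge> 0"
        using xy u by (intro exI[of _ "(ln u - ln x - 1 + x / u) / 2"]) (auto simp: ln_div)
    qed (use xy in simp)
    then have "((ln x + ln y) / 2 + 1) * (y - x) \<le> y * ln y - x * ln x"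
      by (simp add: F_def field_simps)
    then have "(ln x + ln y) / 2 + 1 \<le> (y * ln y - x * ln x) / (y - x)"
      using xy by (simp add: pos_le_divide_eq)
    then show ?thesis using ln_identric_mean[of x y] xy by linarith
  qed
next
  case (sym x y)
  then show ?case by (simp add: add.commute identric_mean_commute)
qed

section \<open>Weighted identric mean: factorization and lower bound\<close>

lemma weighted_identric_mean_eq:
  assumes "a > 0" "b > 0" "0 < v" "v < 1" "a \<noteq> b"
  shows "weighted_identric_mean v a b =
    identric_mean a (a \<nabla>\<^bsub>v\<^esub> b) \<sharp>\<^bsub>v\<^esub> identric_mean (a \<nabla>\<^bsub>v\<^esub> b) b"
proof -
  define m where "m = a \<nabla>\<^bsub>v\<^esub> b"
  have m: "m > 0" using assms weighted_arith_mean_pos by (simp add: m_def)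
  define d where "d = b - a"
  have d: "d \<noteq> 0" using assms by (simp add: d_def)
  \<comment> \<open>These are the denominators in the logarithms of the two identric means. The
    coefficient of \<open>m * ln m\<close> becomes \<open>((1 - v) / v - v / (1 - v)) / d\<close>,
    which equals \<open>(1 - 2 * v) / (v * (1 - v) * d)\<close> and explains the exponent of
    \<open>m\<close>.\<close>
  have md: "m - a = v * d" "b - m = (1 - v) * d"
    by (simp_all add: m_def weighted_arith_mean_def d_def algebra_simps)
  then have ne: "a \<noteq> m" "m \<noteq> b" using assms d by auto
  have W: "weighted_identric_mean v a b = 1 / exp 1
        * m powr ((1 - 2 * v) * m / (v * (1 - v) * d))
        * ((b powr (v * b / (1 - v))) / (a powr ((1 - v) * a / v))) powr (1 / d)"
    using assms by (simp add: weighted_identric_mean_def m_def d_def)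
  have "ln (weighted_identric_mean v a b) =
      (1 - 2 * v) * m / (v * (1 - v) * d) * ln m
      + (v * b / (1 - v) * ln b - (1 - v) * a / v * ln a) / d - 1"
    unfolding W using assms m by (simp add: ln_mult ln_powr ln_div)
  also have "\<dots> = (1 - v) * ((m * ln m - a * ln a) / (v * d) - 1)
      + v * ((b * ln b - m * ln m) / ((1 - v) * d) - 1)"
  proof -
    have "v \<noteq> 0" "1 - v \<noteq> 0" using assms by auto
    with d show ?thesis
      by (simp add: divide_simps) (simp add: algebra_simps)
  qed
  also have "\<dots> = ln (identric_mean a m \<sharp>\<^bsub>v\<^esub> identric_mean m b)"
    using assms m ne by (simp add: ln_weighted_geom_mean identric_mean_pos ln_identric_mean md)
  finally have "ln (weighted_identric_mean v a b) = ln (identric_mean a m \<sharp>\<^bsub>v\<^esub> identric_mean m b)" .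
  moreover have "weighted_identric_mean v a b > 0"
    unfolding W using assms m by simp
  moreover have "identric_mean a m \<sharp>\<^bsub>v\<^esub> identric_mean m b > 0"
    using assms m by (simp add: weighted_geom_mean_pos identric_mean_pos)
  ultimately show ?thesis by (simp add: m_def)
qed

lemma geom_mean_le_weighted_identric_mean:
  assumes "a > 0" "b > 0" "0 < v" "v < 1" "a \<noteq> b"
  shows "(a \<sharp>\<^bsub>v\<^esub> b) \<sharp> (a \<nabla>\<^bsub>v\<^esub> b) \<le> weighted_identric_mean v a b"
proof -
  define m where "m = a \<nabla>\<^bsub>v\<^esub> b"
  define g where "g = a \<sharp>\<^bsub>v\<^esub> b"
  have pos: "m > 0" "g > 0"
    using assms weighted_arith_mean_pos weighted_geom_mean_pos by (simp_all add: m_def g_def)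
  \<comment> \<open>The two halves of \<open>ln m\<close> carry total weight \<open>1/2\<close>,
    while \<open>ln a\<close> and \<open>ln b\<close> combine to half of \<open>ln g\<close>. The
    right side is thus the weighted sum of the trapezoidal bounds for the pairs \<open>a\<close>,
    \<open>m\<close> and \<open>m\<close>, \<open>b\<close>.\<close>
  have "ln (g \<sharp> m) = (1 - v) * ((ln a + ln m) / 2) + v * ((ln m + ln b) / 2)"
    using pos assms ln_weighted_geom_mean[of a b v]
    by (simp add: geom_mean_def g_def ln_sqrt ln_mult field_simps)
  also have "\<dots> \<le> (1 - v) * ln (identric_mean a m) + v * ln (identric_mean m b)"
    using assms pos by (intro add_mono mult_left_mono ln_identric_mean_ge) auto
  also have "\<dots> = ln (weighted_identric_mean v a b)"
    using assms pos
    by (simp add: weighted_identric_mean_eq ln_weighted_geom_mean identric_mean_pos m_def)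
  finally show ?thesis
    using assms pos weighted_identric_mean_eq[OF assms]
    by (simp add: geom_mean_def m_def g_def identric_mean_pos weighted_geom_mean_pos)
qed

section \<open>The middle term of the second chain\<close>

lemma sqrt_weighted_geom_mean:
  assumes "a > 0" "b > 0"
  shows "sqrt a \<sharp>\<^bsub>v\<^esub> sqrt b = sqrt (a \<sharp>\<^bsub>v\<^esub> b)"
  using assms
  by (simp add: weighted_geom_mean_def powr_powr mult.commute powr_mult flip: powr_half_sqrt)

text \<open>Both arguments of the outer geometric mean contain the factor \<open>r\<close>: they are
  \<open>sqrt a * r\<close> and \<open>sqrt b * r\<close>. Since the weights sum to 1,
  \<open>r\<close> comes out of that mean unchanged.\<close>

lemma mixed_mean_eq:
  assumes "a > 0" "b > 0" "0 \<le> v" "v \<le> 1"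
  shows "(a \<nabla>\<^bsub>v\<^esub> (a \<sharp> b)) \<sharp>\<^bsub>v\<^esub> ((a \<sharp> b) \<nabla>\<^bsub>v\<^esub> b) = sqrt (a \<sharp>\<^bsub>v\<^esub> b) * (sqrt a \<nabla>\<^bsub>v\<^esub> sqrt b)"
proof -
  define r where "r = sqrt a \<nabla>\<^bsub>v\<^esub> sqrt b"
  have r: "r > 0" using assms weighted_arith_mean_pos by (simp add: r_def)
  have "a \<nabla>\<^bsub>v\<^esub> (a \<sharp> b) = sqrt a * r" "(a \<sharp> b) \<nabla>\<^bsub>v\<^esub> b = sqrt b * r"
    using assms
    by (simp_all add: r_def weighted_arith_mean_def geom_mean_def real_sqrt_mult algebra_simps)
  moreover have "(sqrt a * r) \<sharp>\<^bsub>v\<^esub> (sqrt b * r) = (sqrt a \<sharp>\<^bsub>v\<^esub> sqrt b) * (r \<sharp>\<^bsub>v\<^esub> r)"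
    using assms r by (simp add: weighted_geom_mean_def powr_mult)
  moreover note sqrt_weighted_geom_mean[OF assms(1,2), of v]
  ultimately show ?thesis using r by (simp add: r_def weighted_geom_mean_same)
qed

lemma weighted_arith_mean_sqrt_le:
  assumes "a > 0" "b > 0" "0 \<le> v" "v \<le> 1"
  shows "sqrt a \<nabla>\<^bsub>v\<^esub> sqrt b \<le> sqrt (a \<nabla>\<^bsub>v\<^esub> b)"
  \<comment> \<open>Concavity of the square root is the case \<open>t = 1/2\<close>.\<close>
  using powr_concave[of a b v "1/2"] assms weighted_arith_mean_pos[of a b v]
  by (simp add: powr_half_sqrt weighted_arith_mean_def)

lemma weighted_geom_mean_le_mixed_mean:
  assumes "a > 0" "b > 0" "0 \<le> v" "v \<le> 1"
  shows "a \<sharp>\<^bsub>v\<^esub> b \<le> (a \<nabla>\<^bsub>v\<^esub> (a \<sharp> b)) \<sharp>\<^bsub>v\<^esub> ((a \<sharp> b) \<nabla>\<^bsub>v\<^esub> b)"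
proof -
  \<comment> \<open>Weighted AM-GM for \<open>sqrt a\<close> and \<open>sqrt b\<close>; multiplying
    by the left side then gives \<open>G\<close> on the left and the product form of the mixed mean
    on the right.\<close>
  have "sqrt (a \<sharp>\<^bsub>v\<^esub> b) \<le> sqrt a \<nabla>\<^bsub>v\<^esub> sqrt b"
    using weighted_geom_mean_le_arith_mean[of "sqrt a" "sqrt b" v] assms
    by (simp add: sqrt_weighted_geom_mean)
  then have "sqrt (a \<sharp>\<^bsub>v\<^esub> b) * sqrt (a \<sharp>\<^bsub>v\<^esub> b) \<le> sqrt (a \<sharp>\<^bsub>v\<^esub> b) * (sqrt a \<nabla>\<^bsub>v\<^esub> sqrt b)"
    using weighted_geom_mean_pos[of a b v] assms by (intro mult_left_mono) auto
  then show ?thesis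
    using weighted_geom_mean_pos[of a b v] assms by (simp add: mixed_mean_eq)
qed

lemma mixed_mean_le_weighted_identric_mean:
  assumes "a > 0" "b > 0" "0 < v" "v < 1" "a \<noteq> b"
  shows "(a \<nabla>\<^bsub>v\<^esub> (a \<sharp> b)) \<sharp>\<^bsub>v\<^esub> ((a \<sharp> b) \<nabla>\<^bsub>v\<^esub> b) \<le> weighted_identric_mean v a b"
proof -
  have "(a \<nabla>\<^bsub>v\<^esub> (a \<sharp> b)) \<sharp>\<^bsub>v\<^esub> ((a \<sharp> b) \<nabla>\<^bsub>v\<^esub> b) = sqrt (a \<sharp>\<^bsub>v\<^esub> b) * (sqrt a \<nabla>\<^bsub>v\<^esub> sqrt b)"
    using assms by (simp add: mixed_mean_eq)
  also have "\<dots> \<le> sqrt (a \<sharp>\<^bsub>v\<^esub> b) * sqrt (a \<nabla>\<^bsub>v\<^esub> b)"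
    using assms weighted_geom_mean_pos[of a b v]
    by (intro mult_left_mono weighted_arith_mean_sqrt_le) auto
  also have "\<dots> = (a \<sharp>\<^bsub>v\<^esub> b) \<sharp> (a \<nabla>\<^bsub>v\<^esub> b)"
    by (simp add: geom_mean_def real_sqrt_mult)
  also have "\<dots> \<le> weighted_identric_mean v a b"
    using assms by (rule geom_mean_le_weighted_identric_mean)
  finally show ?thesis .
qed

theorem theorem2p5:
  fixes a b v :: real
  assumes "a > 0" and "b > 0" and "0 \<le> v" and "v \<le> 1"
  shows "(weighted_log_mean v a b \<le> log_mean (a \<sharp>\<^bsub>v\<^esub> b) (a \<nabla>\<^bsub>v\<^esub> b)
          \<and> log_mean (a \<sharp>\<^bsub>v\<^esub> b) (a \<nabla>\<^bsub>v\<^esub> b) \<le> identric_mean (a \<sharp>\<^bsub>v\<^esub> b) (a \<nabla>\<^bsub>v\<^esub> b)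
          \<and> identric_mean (a \<sharp>\<^bsub>v\<^esub> b) (a \<nabla>\<^bsub>v\<^esub> b) \<le> (a \<sharp>\<^bsub>v\<^esub> b) \<nabla> (a \<nabla>\<^bsub>v\<^esub> b))
       \<and> (a \<sharp>\<^bsub>v\<^esub> b \<le> (a \<nabla>\<^bsub>v\<^esub> (a \<sharp> b)) \<sharp>\<^bsub>v\<^esub> ((a \<sharp> b) \<nabla>\<^bsub>v\<^esub> b)
          \<and> (a \<nabla>\<^bsub>v\<^esub> (a \<sharp> b)) \<sharp>\<^bsub>v\<^esub> ((a \<sharp> b) \<nabla>\<^bsub>v\<^esub> b) \<le> weighted_identric_mean v a b)"
proof -
  have pos: "a \<sharp>\<^bsub>v\<^esub> b > 0" "a \<nabla>\<^bsub>v\<^esub> b > 0" "a \<sharp> b > 0"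
    using assms weighted_geom_mean_pos weighted_arith_mean_pos by (simp_all add: geom_mean_def)
  \<comment> \<open>These two inequalities involve the weighted means defined by cases. For
    \<open>v = 0\<close>, \<open>v = 1\<close> or \<open>a = b\<close> the prescribed values make
    both sides equal; otherwise the decompositions apply.\<close>
  have "weighted_log_mean v a b \<le> log_mean (a \<sharp>\<^bsub>v\<^esub> b) (a \<nabla>\<^bsub>v\<^esub> b)
      \<and> (a \<nabla>\<^bsub>v\<^esub> (a \<sharp> b)) \<sharp>\<^bsub>v\<^esub> ((a \<sharp> b) \<nabla>\<^bsub>v\<^esub> b) \<le> weighted_identric_mean v a b"
  proof -
    consider "v = 0" | "v = 1" | "a = b" "v \<noteq> 0" "v \<noteq> 1" | "0 < v" "v < 1" "a \<noteq> b"
      using assms by linarith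
    then show ?thesis
    proof cases
      case 3
      then show ?thesis
        using assms
        by (simp add: weighted_log_mean_def weighted_identric_mean_def log_mean_def geom_mean_def
            weighted_geom_mean_same weighted_arith_mean_same)
    next
      case 4
      then show ?thesis
        using assms pos
        by (simp add: weighted_log_mean_eq log_mean_concave mixed_mean_le_weighted_identric_mean)
    qed (use assms pos in \<open>simp_all add: weighted_log_mean_def weighted_identric_mean_def
           log_mean_def weighted_geom_mean_def weighted_arith_mean_def\<close>)
  qed
  then show ?thesis
    using assms pos
    by (simp add: log_mean_le_identric_mean identric_mean_le_arith_mean
        weighted_geom_mean_le_mixed_mean)
qed

end
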